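(* Let $A,B\subseteq\mathbb{R}$ be non-empty and compact, where $\mathbb{R}$ carries the usual metric $d(x,y)=|x-y|$. Then for all $t>0$, $$\kappa^t(A+B)\ \ge\ \kappa^t(A)+\kappa^t(B).$$ Further, if $\lambda\in[0,1]$, then for all $t>0$, $$\kappa^t\big((1-\lambda)A+\lambda B\big)\ \ge\ (1-\lambda)\,\kappa^t(A)+\lambda\,\kappa^t(B).$$
   Context: For $A,B\subseteq\mathbb{R}$ and $c\in\mathbb{R}$: $A+B=\{a+b: a\in A, b\in B\}$ and $cA=\{ca: a\in A\}$. Complexity. Let $(F,\rho)$ be a non-empty finite metric space and $Z(x,y)=e^{-\rho(x,y)}$. For a probability measure $p=(p_x)_{x\in F}$ on $F$ put $(Zp)_x=\sum_{y\in F}Z(x,y)p_y$ and, for $\alpha\in[0,\infty]$, $$H^Z_\alpha(p)=\begin{cases}\frac{1}{1-\alpha}\log\left(\sum_x p_x (Zp)_x^{\alpha-1}\right), & \alpha\in[0,1)\cup(1,\infty),\\ -\sum_x p_x\log (Zp)_x, & \alpha=1,\\ -\log\left(\max_{x:\,p_x>0}(Zp)_x\right), & \alpha=\infty.\end{cases}$$ The complexity of $(F,\rho)$ is $\sup_p H^Z_\alpha(p)$, the supremum being over all probability measures $p$ on $F$; by a known theorem of Leinster and Meckes this value does not depend on the choice of $\alpha\in[0,\infty]$. For a metric space $(X,d)$, $t>0$ and a non-empty finite $F\subseteq X$, $C^t(F)$ is the complexity of the metric space $(F,td)$; by convention $C^t(\emptyset)=0$. For compact $K\subseteq X$, $C^t(K)=\sup\{C^t(F):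 F\subseteq K,\ F \text{ finite}\}$. Finally $\kappa^t(K)=\exp\{C^t(K)\}-1$. *)

theory Defs
  imports "HOL-Probability.Probability" "HOL-Library.Set_Algebras"
begin

text \<open>
  A finite metric space is given by its carrier \<open>F\<close> and a distance function \<open>\<rho>\<close>.
  A probability measure on \<open>F\<close> is a \<open>pmf\<close> whose support lies in \<open>F\<close>.
\<close>

definition Zp :: "'a set \<Rightarrow> ('a \<Rightarrow> 'a \<Rightarrow> real) \<Rightarrow> 'a pmf \<Rightarrow> 'a \<Rightarrow> real" where
  "Zp F \<rho> p x = (\<Sum>y\<in>F. exp (- \<rho> x y) * pmf p y)"

text \<open>
  The order \<open>\<alpha>\<close> ranges over \<open>[0, \<infinity>]\<close>, which is the type \<open>ennreal\<close>. For \<open>x \<in> F\<close> and a finite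
  \<open>F\<close> supporting \<open>p\<close> one has \<open>Zp F \<rho> p x > 0\<close>, so \<open>powr\<close> and \<open>ln\<close> have their usual meaning.
\<close>

definition entropyZ :: "'a set \<Rightarrow> ('a \<Rightarrow> 'a \<Rightarrow> real) \<Rightarrow> ennreal \<Rightarrow> 'a pmf \<Rightarrow> real" where
  "entropyZ F \<rho> \<alpha> p =
    (if \<alpha> = \<infinity> then - ln (Max (Zp F \<rho> p ` {x \<in> F. pmf p x > 0}))
     else if \<alpha> = 1 then - (\<Sum>x\<in>F. pmf p x * ln (Zp F \<rho> p x))
     else 1 / (1 - enn2real \<alpha>) * ln (\<Sum>x\<in>F. pmf p x * Zp F \<rho> p x powr (enn2real \<alpha> - 1)))"

text \<open>
  By a theorem of Leinster and Meckes the following supremum does not depend on \<open>\<alpha>\<close>. No value of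
  \<open>\<alpha>\<close> is singled out: the order stays a parameter of all derived notions, to be universally
  quantified wherever they are used. For a metric \<open>\<rho>\<close> and
  non-empty \<open>F\<close> the set of entropies is bounded (by \<open>0\<close> and \<open>ln (card F)\<close>),
  so the real-valued \<open>SUP\<close> is a genuine supremum.
\<close>

definition complexity :: "ennreal \<Rightarrow> 'a set \<Rightarrow> ('a \<Rightarrow> 'a \<Rightarrow> real) \<Rightarrow> real" where
  "complexity \<alpha> F \<rho> = (SUP p \<in> {p. set_pmf p \<subseteq> F}. entropyZ F \<rho> \<alpha> p)"

definition C_fin :: "ennreal \<Rightarrow> real \<Rightarrow> 'a::metric_space set \<Rightarrow> real" where
  "C_fin \<alpha> t F = (if F = {} then 0 else complexity \<alpha> F (\<lambda>x y. t * dist x y))"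

text \<open>
  For compact \<open>K\<close> and \<open>t > 0\<close> the complexities of the finite subsets of \<open>K\<close> are bounded above
  (cover \<open>K\<close> by finitely many balls), so the real-valued \<open>SUP\<close> is again a genuine supremum.
\<close>

definition C_compact :: "ennreal \<Rightarrow> real \<Rightarrow> 'a::metric_space set \<Rightarrow> real" where
  "C_compact \<alpha> t K = (SUP F \<in> {F. F \<subseteq> K \<and> finite F}. C_fin \<alpha> t F)"

definition kappa :: "ennreal \<Rightarrow> real \<Rightarrow> 'a::metric_space set \<Rightarrow> real" where
  "kappa \<alpha> t K = exp (C_compact \<alpha> t K) - 1"

end

theory Submission
  imports Defs
begin

text \<open>
  On the line the kernel is multiplicative along the order: \<open>Z x z = Z x y * Z y z\<close> for
  \<open>x \<le> y \<le> z\<close>. Peeling off the least point of a finite set \<open>F\<close>, one therefore obtains by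
  recursion a positive weighting \<open>w\<close> with \<open>Z w = 1\<close> on \<open>F\<close> and total mass
  \<open>M = 1 + (\<Sum> tanh (t g / 2))\<close>, the sum ranging over the gaps \<open>g\<close> between consecutive points; hence
  \<open>w / M\<close> has entropy \<open>ln M\<close> for every order. Conversely, Jensen's inequality bounds every
  entropy of \<open>p\<close> by \<open>ln (\<Sum>x. p x / Zp x)\<close>, and the same recursion shows that this sum is at most
  \<open>M\<close>. So \<open>\<kappa>\<close> is the supremum of the gap sums \<open>(\<Sum> tanh (t g / 2))\<close>. A translate of \<open>F\<close> followed by a
  translate of \<open>G\<close>, sharing one point, is a subset of \<open>F + G\<close> whose gap sum is the sum of those of
  \<open>F\<close> and \<open>G\<close>; the statement for dilates follows from the concavity of \<open>tanh\<close> on \<open>[0, \<infinity>)\<close>.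
\<close>

section \<open>Entropies of finite spaces\<close>

lemma Zp_pos:
  assumes "finite F" "set_pmf p \<subseteq> F"
  shows "Zp F \<rho> p x > 0"
proof -
  obtain y where "y \<in> set_pmf p"
    using set_pmf_not_empty[of p] by blast
  then have "y \<in> F" "pmf p y > 0"
    using assms by (auto simp: pmf_positive)
  then show ?thesis
    unfolding Zp_def using assms by (intro sum_pos2[of _ y]) auto
qed

text \<open>\<open>\<Sum>x\<in>F. pmf p x / Zp F \<rho> p x\<close> is the exponential of the entropy of order \<open>0\<close>.\<close>

lemma entropyZ_le:
  assumes F: "finite F" "set_pmf p \<subseteq> F"
  shows "entropyZ F \<rho> \<alpha> p \<le> ln (\<Sum>x\<in>F. pmf p x / Zp F \<rho> p x)"
proof -
  define u where "u = Zp F \<rho> p"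
  define D where "D = (\<Sum>x\<in>F. pmf p x / u x)"
  have u: "u x > 0" for x
    unfolding u_def by (rule Zp_pos[OF F])
  have p1: "(\<Sum>x\<in>F. pmf p x) = 1"
    using F by (rule sum_pmf_eq_1)
  have ne: "F \<noteq> {}"
    using F set_pmf_not_empty[of p] by blast
  obtain z where z: "z \<in> F" "pmf p z > 0"
    using F set_pmf_not_empty[of p] by (metis all_not_in_conv pmf_positive subsetD)
  have D: "D > 0"
    unfolding D_def using z u F by (intro sum_pos2[of _ z]) (auto simp: less_imp_le)
  have jensen: "- (\<Sum>x\<in>F. pmf p x * ln (u x)) \<le> ln D"
  proof -
    have "ln (\<Sum>x\<in>F. pmf p x *\<^sub>R (1 / u x)) \<ge> (\<Sum>x\<in>F. pmf p x * ln (1 / u x))"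
      using F ne p1 u ln_concave by (intro concave_on_sum) auto
    moreover have "ln (1 / u x) = - ln (u x)" for x
      using u[of x] by (simp add: ln_div)
    ultimately show ?thesis
      by (simp add: D_def sum_negf)
  qed
  consider "\<alpha> = \<infinity>" | "\<alpha> = 1" | "\<alpha> \<noteq> \<infinity>" "\<alpha> < 1" | "\<alpha> \<noteq> \<infinity>" "\<alpha> > 1"
    by fastforce
  then have "entropyZ F \<rho> \<alpha> p \<le> ln D"
  proof cases
    case 1
    define m where "m = Max (u ` {x \<in> F. pmf p x > 0})"
    have le: "u x \<le> m" if "x \<in> F" "pmf p x > 0" for x
      unfolding m_def using that F by (intro Max_ge) auto
    then have m: "m > 0"
      using u[of z] z by fastforce
    have "1 / m = (\<Sum>x\<in>F. pmf p x / m)"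
      using p1 by (simp flip: sum_divide_distrib)
    also have "\<dots> \<le> D"
      unfolding D_def
    proof (intro sum_mono)
      fix x assume "x \<in> F"
      then show "pmf p x / m \<le> pmf p x / u x"
        using le[of x] u[of x] m
        by (cases "pmf p x = 0") (auto intro!: divide_left_mono simp: pmf_pos)
    qed
    finally have "ln (1 / m) \<le> ln D"
      using m by (intro ln_mono) auto
    then show ?thesis
      using 1 m by (simp add: entropyZ_def m_def u_def ln_div)
  next
    case 2
    then show ?thesis
      using jensen by (simp add: entropyZ_def u_def)
  next
    case 3
    define s where "s = 1 - enn2real \<alpha>"
    have s: "0 < s" "s \<le> 1"
      using 3 unfolding s_def
      by (cases \<alpha>; simp)+
    \<comment> \<open>Young's inequality with second factor \<open>1\<close> is the tangent line
      bound for the concave function \<open>y powr s\<close> at \<open>y = D\<close>. Averaged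
      against \<open>p\<close>, the right-hand side becomes \<open>D powr s\<close>, because
      \<open>D\<close> is the mean of \<open>1 / u\<close>.\<close>
    have young: "(1 / u x) powr s \<le> D powr s * (s * (1 / u x / D) + (1 - s))" for x
    proof -
      have "(1 / u x / D) powr s * 1 powr (1 - s) \<le> s * (1 / u x / D) + (1 - s) * 1"
        using s u[of x] D by (intro Youngs_inequality_0) auto
      then have "(1 / u x) powr s / D powr s \<le> s * (1 / u x / D) + (1 - s)"
        using u[of x] D by (subst (asm) powr_divide) auto
      then show ?thesis
        using D by (simp add: pos_divide_le_eq mult.commute)
    qed
    have "(\<Sum>x\<in>F. pmf p x * u x powr (- s)) = (\<Sum>x\<in>F. pmf p x * (1 / u x) powr s)"
      using u by (intro sum.cong) (auto simp: powr_divide powr_minus_divide less_imp_le)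
    also have "\<dots> \<le> (\<Sum>x\<in>F. pmf p x * (D powr s * (s * (1 / u x / D) + (1 - s))))"
      by (intro sum_mono mult_left_mono young) auto
    also have "\<dots> = (\<Sum>x\<in>F. D powr s * (s / D * (pmf p x / u x) + (1 - s) * pmf p x))"
      by (intro sum.cong) (auto simp: algebra_simps)
    also have "\<dots> = D powr s * (s / D * D + (1 - s) * (\<Sum>x\<in>F. pmf p x))"
      by (simp only: sum.distrib D_def[symmetric] flip: sum_distrib_left)
    also have "\<dots> = D powr s"
      using D p1 by simp
    finally have le: "(\<Sum>x\<in>F. pmf p x * u x powr (- s)) \<le> D powr s" .
    have "0 < (\<Sum>x\<in>F. pmf p x * u x powr (- s))"
      using z u[of z] F by (intro sum_pos2[of _ z]) auto
    then have "ln (\<Sum>x\<in>F. pmf p x * u x powr (- s)) \<le> s * ln D"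
      using le D by (metis ln_le_cancel_iff ln_powr powr_gt_zero less_irrefl)
    then show ?thesis
      using 3 s by (auto simp: entropyZ_def u_def s_def field_simps)
  next
    case 4
    define r where "r = enn2real \<alpha> - 1"
    have r: "0 < r"
      using 4 unfolding r_def
      by (cases \<alpha>) auto
    have pos: "0 < (\<Sum>x\<in>F. pmf p x * u x powr r)"
      using z u[of z] F by (intro sum_pos2[of _ z]) auto
    \<comment> \<open>Concavity of \<open>ln\<close> bounds the entropy of order \<alpha> > 1 by
      that of order 1, which \<open>jensen\<close> controls.\<close>
    have "ln (\<Sum>x\<in>F. pmf p x *\<^sub>R (u x powr r)) \<ge> (\<Sum>x\<in>F. pmf p x * ln (u x powr r))"
      using F ne p1 ln_concave
      by (intro concave_on_sum) (auto simp: u[THEN less_imp_neq, THEN not_sym])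
    moreover have "ln (u x powr r) = r * ln (u x)" for x
      using u[of x] by (simp add: ln_powr)
    ultimately have "r * (\<Sum>x\<in>F. pmf p x * ln (u x)) \<le> ln (\<Sum>x\<in>F. pmf p x * u x powr r)"
      by (simp add: sum_distrib_left mult.left_commute)
    then have "- (ln (\<Sum>x\<in>F. pmf p x * u x powr r) / r) \<le> - (\<Sum>x\<in>F. pmf p x * ln (u x))"
      using r by (simp add: field_simps)
    moreover have "1 / (1 - enn2real \<alpha>) * c = - (c / r)" for c
      using minus_divide_right[of c r] by (simp add: r_def)
    ultimately show ?thesis
      using 4 jensen by (auto simp: entropyZ_def u_def r_def)
  qed
  then show ?thesis
    by (simp add: D_def u_def)
qed

text \<open>Every order takes some mean of the values of \<open>Zp\<close> on the support, and all
  means of a constant agree. This evaluates the entropy of a normalised weighting.\<close>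

lemma entropyZ_const:
  assumes F: "finite F" "set_pmf p \<subseteq> F" and c: "c > 0" "\<And>x. x \<in> F \<Longrightarrow> Zp F \<rho> p x = c"
  shows "entropyZ F \<rho> \<alpha> p = - ln c"
proof -
  have p1: "(\<Sum>x\<in>F. pmf p x) = 1"
    using F by (rule sum_pmf_eq_1)
  obtain z where z: "z \<in> F" "pmf p z > 0"
    using F set_pmf_not_empty[of p] by (metis all_not_in_conv pmf_positive subsetD)
  have "Zp F \<rho> p ` {x \<in> F. pmf p x > 0} = {c}"
    using z c by force
  moreover have "(\<Sum>x\<in>F. pmf p x * ln (Zp F \<rho> p x)) = ln c"
    using c p1 by (simp flip: sum_distrib_right)
  moreover have "(\<Sum>x\<in>F. pmf p x * Zp F \<rho> p x powr a) = c powr a" for a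
    using c p1 by (simp flip: sum_distrib_right)
  moreover have "enn2real \<alpha> \<noteq> 1" if "\<alpha> \<noteq> \<infinity>" "\<alpha> \<noteq> 1"
    using that by (metis ennreal_1 ennreal_enn2real_if infinity_ennreal_def)
  ultimately show ?thesis
    using c(1) by (auto simp: entropyZ_def ln_powr field_simps)
qed

section \<open>Finite subsets of the line\<close>

text \<open>For a non-empty strictly increasing list this is the magnitude of the scaled point set,
  minus 1. The value 0 on \<open>[]\<close> matches the convention that the empty set has complexity
  0.\<close>

fun gap_sum :: "real \<Rightarrow> real list \<Rightarrow> real" where
  "gap_sum t (x # y # xs) = tanh (t * (y - x) / 2) + gap_sum t (y # xs)"
| "gap_sum t _ = 0"

lemma gap_sum_nonneg:
  assumes "t > 0" "sorted_wrt (<) xs"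
  shows "gap_sum t xs \<ge> 0"
  using assms by (induction t xs rule: gap_sum.induct) auto

lemma exp_dist_split:
  fixes x y z :: real
  assumes "x \<le> y" "y \<le> z"
  shows "exp (- (t * dist x z)) = exp (- (t * dist x y)) * exp (- (t * dist y z))"
  using assms by (simp add: dist_real_def algebra_simps flip: exp_add)

lemma tanh_half_gap:
  fixes x y :: real
  assumes "x \<le> y"
  shows "tanh (t * (y - x) / 2) = (1 - exp (- (t * dist x y))) / (1 + exp (- (t * dist x y)))"
  using assms by (simp add: tanh_real_altdef dist_real_def)

text \<open>The bound \<open>w (hd xs) \<ge> 1 / 2\<close> strengthens the induction: a new least
  point takes \<open>a / (1 + a) \<le> 1 / 2\<close> from the old head, which thus stays
  non-negative, and itself receives \<open>1 / (1 + a) \<ge> 1 / 2\<close>.\<close>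

lemma weighting_exists:
  assumes "t > 0" "sorted_wrt (<) xs" "xs \<noteq> []"
  shows "\<exists>w. (\<forall>x. w x \<ge> 0) \<and> w (hd xs) \<ge> 1 / 2 \<and> (\<Sum>x\<in>set xs. w x) = 1 + gap_sum t xs \<and>
    (\<forall>x\<in>set xs. (\<Sum>y\<in>set xs. exp (- (t * dist x y)) * w y) = 1)"
  using assms
proof (induction t xs rule: gap_sum.induct)
  case (1 t x y xs)
  let ?R = "set (y # xs)"
  obtain w where w: "\<And>z. w z \<ge> 0" "w y \<ge> 1 / 2" "(\<Sum>z\<in>?R. w z) = 1 + gap_sum t (y # xs)"
    "\<And>z. z \<in> ?R \<Longrightarrow> (\<Sum>v\<in>?R. exp (- (t * dist z v)) * w v) = 1"
  proof -
    have "t > 0" "sorted_wrt (<) (y # xs)" "y # xs \<noteq> []"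
      using "1.prems" by auto
    from "1.IH"[OF this] show thesis
      unfolding list.sel(1) using that by blast
  qed
  define a where "a = exp (- (t * dist x y))"
  have a: "0 < a" "a < 1"
    using "1.prems" by (auto simp: a_def dist_real_def)
  have x: "x \<notin> ?R" and y: "y \<in> ?R" and xy: "x < y"
    using "1.prems" by auto
  have split: "exp (- (t * dist x z)) = a * exp (- (t * dist y z))" if "z \<in> ?R" for z
    unfolding a_def using that "1.prems" by (intro exp_dist_split) auto
  \<comment> \<open>Put weight \<open>c\<close> on \<open>x\<close> and take \<open>d\<close> from
    \<open>y\<close>. The equations at points of \<open>?R\<close> force \<open>d = a * c\<close>;
    the one at \<open>x\<close> reads \<open>c + a * (1 - d) = 1\<close>, so
    \<open>c = 1 / (1 + a)\<close>.\<close>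
  define w' where "w' = w(x := 1 / (1 + a), y := w y - a / (1 + a))"
  have sum_w': "(\<Sum>z\<in>?R. f z * w' z) = (\<Sum>z\<in>?R. f z * w z) - f y * (a / (1 + a))" for f
  proof -
    have "(\<Sum>z\<in>?R. f z * w' z) = (\<Sum>z\<in>?R. f z * w z - (if z = y then f y * (a / (1 + a)) else 0))"
      using x by (intro sum.cong) (auto simp: w'_def algebra_simps)
    then show ?thesis
      using y by (simp only: sum_subtractf sum.delta' sum.delta finite_set if_True)
  qed
  have x1: "w' x = 1 / (1 + a)"
    using xy by (simp add: w'_def)
  have half: "a / (1 + a) \<le> 1 / 2" "1 / 2 \<le> 1 / (1 + a)"
    using a by (simp_all add: field_simps)
  have set: "set (x # y # xs) = insert x ?R"
    by simp
  have "w' z \<ge> 0" for z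
    using w(1)[of z] w(2) half a by (simp add: w'_def del: le_divide_eq_numeral1 divide_le_eq_numeral1)
  moreover have "w' (hd (x # y # xs)) \<ge> 1 / 2"
    using half x1 by simp
  moreover have "(\<Sum>z\<in>set (x # y # xs). w' z) = 1 + gap_sum t (x # y # xs)"
  proof -
    have "(\<Sum>z\<in>set (x # y # xs). w' z) = 1 / (1 + a) + ((1 + gap_sum t (y # xs)) - a / (1 + a))"
      using sum_w'[of "\<lambda>_. 1"] w(3) x x1 unfolding set by (subst sum.insert) auto
    also have "1 / (1 + a) - a / (1 + a) = tanh (t * (y - x) / 2)"
      using xy by (simp add: tanh_half_gap a_def diff_divide_distrib)
    then have "1 / (1 + a) + ((1 + gap_sum t (y # xs)) - a / (1 + a)) = 1 + gap_sum t (x # y # xs)"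
      by simp
    finally show ?thesis .
  qed
  moreover have "(\<Sum>v\<in>set (x # y # xs). exp (- (t * dist z v)) * w' v) = 1"
    if z: "z \<in> set (x # y # xs)" for z
  proof (cases "z = x")
    case True
    have "(\<Sum>v\<in>?R. exp (- (t * dist x v)) * w' v) = a * (\<Sum>v\<in>?R. exp (- (t * dist y v)) * w' v)"
      unfolding sum_distrib_left by (intro sum.cong) (auto simp only: split mult.assoc)
    also have "\<dots> = a * (1 - a / (1 + a))"
      unfolding sum_w' using w(4)[OF y] by simp
    finally have "(\<Sum>v\<in>set (x # y # xs). exp (- (t * dist x v)) * w' v)
        = 1 / (1 + a) + a * (1 - a / (1 + a))"
      using x x1 unfolding set by (subst sum.insert) auto
    also have "\<dots> = 1"
      using a by (simp add: field_simps)
    finally show ?thesis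
      unfolding True .
  next
    case False
    then have zR: "z \<in> ?R"
      using z by simp
    have "(\<Sum>v\<in>?R. exp (- (t * dist z v)) * w' v) = 1 - exp (- (t * dist y z)) * (a / (1 + a))"
      unfolding sum_w' using w(4)[OF zR] by (simp add: dist_commute)
    moreover have "exp (- (t * dist z x)) = a * exp (- (t * dist y z))"
      using split[OF zR] by (simp add: dist_commute)
    ultimately show ?thesis
      using x x1 unfolding set by (subst sum.insert) auto
  qed
  ultimately show ?case
    by blast
qed (auto intro!: exI[of _ "\<lambda>_. 1"])

text \<open>The signs of \<open>p\<close> do not matter, only those of \<open>Z p\<close>; this is what the recursion preserves.\<close>

lemma sum_div_le_gap_sum:
  assumes "t > 0" "sorted_wrt (<) xs" "xs \<noteq> []"
    "\<And>x. x \<in> set xs \<Longrightarrow> (\<Sum>y\<in>set xs. exp (- (t * dist x y)) * p y) > 0"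
  shows "(\<Sum>x\<in>set xs. p x / (\<Sum>y\<in>set xs. exp (- (t * dist x y)) * p y)) \<le> 1 + gap_sum t xs"
  using assms
proof (induction t xs arbitrary: p rule: gap_sum.induct)
  case (1 t x y xs)
  let ?R = "set (y # xs)"
  define u where "u z = (\<Sum>v\<in>set (x # y # xs). exp (- (t * dist z v)) * p v)" for z
  define a where "a = exp (- (t * dist x y))"
  have a: "0 < a" "a < 1"
    using "1.prems" by (auto simp: a_def dist_real_def)
  have x: "x \<notin> ?R" and y: "y \<in> ?R" and xy: "x < y"
    using "1.prems" by auto
  have split: "exp (- (t * dist x z)) = a * exp (- (t * dist y z))" if "z \<in> ?R" for z
    unfolding a_def using that "1.prems" by (intro exp_dist_split) auto
  have set: "set (x # y # xs) = insert x ?R"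
    by simp
  \<comment> \<open>Seen from \<open>?R\<close>, mass \<open>p x\<close> at \<open>x\<close> acts
    like mass \<open>a * p x\<close> at \<open>y\<close>. Moving it there leaves the values
    \<open>u\<close> on \<open>?R\<close> unchanged, so the induction hypothesis applies to
    \<open>p'\<close>.\<close>
  define p' where "p' = p(y := p y + a * p x)"
  have sum_p': "(\<Sum>z\<in>?R. f z * p' z) = (\<Sum>z\<in>?R. f z * p z) + f y * (a * p x)" for f
  proof -
    have "(\<Sum>z\<in>?R. f z * p' z) = (\<Sum>z\<in>?R. f z * p z + (if z = y then f y * (a * p x) else 0))"
      by (intro sum.cong) (auto simp: p'_def algebra_simps)
    then show ?thesis
      using y by (simp only: sum.distrib sum.delta' sum.delta finite_set if_True)
  qed
  have u': "(\<Sum>v\<in>?R. exp (- (t * dist z v)) * p' v) = u z" if z: "z \<in> ?R" for z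
  proof -
    have "exp (- (t * dist z x)) = a * exp (- (t * dist z y))"
      using split[OF z] by (simp add: dist_commute)
    then show ?thesis
      unfolding sum_p' u_def set using x by (subst sum.insert) auto
  qed
  have upos: "u z > 0" if "z \<in> set (x # y # xs)" for z
    using "1.prems"(4)[OF that] by (simp only: u_def)
  then have ux: "u x > 0" and uy: "u y > 0"
    by auto
  have "(\<Sum>z\<in>?R. p' z / (\<Sum>v\<in>?R. exp (- (t * dist z v)) * p' v)) \<le> 1 + gap_sum t (y # xs)"
    using "1.prems" upos u' by (intro "1.IH") auto
  moreover have "(\<Sum>z\<in>?R. p' z / (\<Sum>v\<in>?R. exp (- (t * dist z v)) * p' v)) = (\<Sum>z\<in>?R. p' z / u z)"
    by (intro sum.cong) (auto simp only: u')
  moreover have "(\<Sum>z\<in>?R. p' z / u z) = (\<Sum>z\<in>?R. p z / u z) + a * p x / u y"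
    using sum_p'[of "\<lambda>z. 1 / u z"] by simp
  ultimately have rest: "(\<Sum>z\<in>?R. p z / u z) + a * p x / u y \<le> 1 + gap_sum t (y # xs)"
    by simp
  have "u x = p x + (\<Sum>v\<in>?R. exp (- (t * dist x v)) * p v)"
    unfolding u_def set using x by (subst sum.insert) auto
  also have "(\<Sum>v\<in>?R. exp (- (t * dist x v)) * p v) = a * (\<Sum>v\<in>?R. exp (- (t * dist y v)) * p v)"
    unfolding sum_distrib_left by (intro sum.cong) (auto simp only: split mult.assoc)
  also have "(\<Sum>v\<in>?R. exp (- (t * dist y v)) * p v) = u y - a * p x"
    using u'[OF y] unfolding sum_p' by simp
  \<comment> \<open>Solving for \<open>p x\<close> reduces the remaining estimate to an inequality
    in \<open>u x\<close> and \<open>u y\<close> alone.\<close>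
  finally have "(1 - a\<^sup>2) * p x = u x - a * u y"
    by (simp add: algebra_simps power2_eq_square)
  moreover have a2: "1 - a\<^sup>2 > 0"
    using a by (simp add: power_less_one_iff abs_square_less_1)
  ultimately have px: "p x = (u x - a * u y) / (1 - a\<^sup>2)"
    by (simp add: field_simps)
  have "p x / u x - a * p x / u y = ((u x - a * u y) * (u y - a * u x)) / ((1 - a\<^sup>2) * (u x * u y))"
    unfolding px using ux uy a2 by (simp add: divide_simps) (simp add: algebra_simps)
  also have "\<dots> \<le> ((1 - a)\<^sup>2 * (u x * u y)) / ((1 - a\<^sup>2) * (u x * u y))"
  proof (intro divide_right_mono)
    \<comment> \<open>The defect is a multiple of a square and vanishes exactly when
      \<open>u x = u y\<close>, as happens for a multiple of the weighting.\<close>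
    have "(1 - a)\<^sup>2 * (u x * u y) - (u x - a * u y) * (u y - a * u x) = a * (u x - u y)\<^sup>2"
      by (simp add: algebra_simps power2_eq_square)
    moreover have "a * (u x - u y)\<^sup>2 \<ge> 0"
      using a by simp
    ultimately show "(u x - a * u y) * (u y - a * u x) \<le> (1 - a)\<^sup>2 * (u x * u y)"
      by linarith
  qed (use ux uy a2 in auto)
  also have "\<dots> = (1 - a)\<^sup>2 / ((1 - a) * (1 + a))"
  proof -
    have "1 - a\<^sup>2 = (1 - a) * (1 + a)"
      by (simp add: algebra_simps power2_eq_square)
    then show ?thesis
      using ux uy by (subst mult_divide_mult_cancel_right) auto
  qed
  also have "\<dots> = (1 - a) / (1 + a)"
    using a by (simp add: power2_eq_square)
  also have "\<dots> = tanh (t * (y - x) / 2)"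
    using xy by (simp add: tanh_half_gap a_def)
  finally have first: "p x / u x \<le> a * p x / u y + tanh (t * (y - x) / 2)"
    by simp
  have "(\<Sum>z\<in>set (x # y # xs). p z / u z) = p x / u x + (\<Sum>z\<in>?R. p z / u z)"
    unfolding set using x by (subst sum.insert) auto
  also have "\<dots> \<le> 1 + gap_sum t (x # y # xs)"
    using first rest by simp
  finally show ?case
    by (simp only: u_def)
qed auto

text \<open>The supremum is attained at the normalised weighting, whatever the order;
  \<open>entropyZ_le\<close> and \<open>sum_div_le_gap_sum\<close> together give the upper
  bound.\<close>

lemma complexity_set:
  assumes t: "t > 0" and xs: "sorted_wrt (<) xs" "xs \<noteq> []"
  shows "complexity \<alpha> (set xs) (\<lambda>x y. t * dist x y) = ln (1 + gap_sum t xs)"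
proof -
  let ?F = "set xs" and ?\<rho> = "\<lambda>x y::real. t * dist x y"
  define M where "M = 1 + gap_sum t xs"
  have M: "M > 0"
    using gap_sum_nonneg[OF t xs(1)] by (simp add: M_def)
  have upper: "entropyZ ?F ?\<rho> \<alpha> p \<le> ln M" if p: "set_pmf p \<subseteq> ?F" for p
  proof -
    have pos: "Zp ?F ?\<rho> p x > 0" for x
      using p by (intro Zp_pos) auto
    obtain z where z: "z \<in> ?F" "pmf p z > 0"
      using p set_pmf_not_empty[of p] by (metis all_not_in_conv pmf_positive subsetD)
    have "0 < (\<Sum>x\<in>?F. pmf p x / Zp ?F ?\<rho> p x)"
      using z pos by (intro sum_pos2[of _ z]) (auto simp: less_imp_le)
    moreover have "(\<Sum>x\<in>?F. pmf p x / Zp ?F ?\<rho> p x) \<le> M"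
      using sum_div_le_gap_sum[OF t xs, of "pmf p"] pos by (simp add: Zp_def M_def)
    ultimately have "ln (\<Sum>x\<in>?F. pmf p x / Zp ?F ?\<rho> p x) \<le> ln M"
      by simp
    then show ?thesis
      using entropyZ_le[of ?F p ?\<rho> \<alpha>] p by simp
  qed
  obtain w where w: "\<And>x. w x \<ge> 0" "(\<Sum>x\<in>?F. w x) = M"
    "\<And>x. x \<in> ?F \<Longrightarrow> (\<Sum>y\<in>?F. exp (- (t * dist x y)) * w y) = 1"
    using weighting_exists[OF t xs] by (auto simp: M_def)
  define f where "f x = (if x \<in> ?F then w x / M else 0)" for x
  have f0: "f x \<ge> 0" for x
    using w(1) M by (simp add: f_def)
  have "(\<integral>\<^sup>+x. ennreal (f x) \<partial>count_space UNIV) = (\<Sum>x\<in>?F. ennreal (f x))"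
    by (intro nn_integral_count_space') (auto simp: f_def)
  also have "\<dots> = ennreal (\<Sum>x\<in>?F. f x)"
    using f0 by (intro sum_ennreal) auto
  also have "(\<Sum>x\<in>?F. f x) = 1"
    using w(2) M by (simp add: f_def flip: sum_divide_distrib)
  finally have f1: "(\<integral>\<^sup>+x. ennreal (f x) \<partial>count_space UNIV) = 1"
    by simp
  define q where "q = embed_pmf f"
  have q: "pmf q x = f x" for x
    unfolding q_def using f0 f1 by (rule pmf_embed_pmf)
  have qF: "set_pmf q \<subseteq> ?F"
    by (auto simp: set_pmf_iff q f_def split: if_splits)
  have "Zp ?F ?\<rho> q x = 1 / M" if "x \<in> ?F" for x
  proof -
    have "Zp ?F ?\<rho> q x = (\<Sum>y\<in>?F. exp (- (t * dist x y)) * w y / M)"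
      unfolding Zp_def by (intro sum.cong) (auto simp: q f_def)
    then show ?thesis
      using w(3)[OF that] by (simp flip: sum_divide_distrib)
  qed
  then have "entropyZ ?F ?\<rho> \<alpha> q = - ln (1 / M)"
    using qF M by (intro entropyZ_const) auto
  then have "entropyZ ?F ?\<rho> \<alpha> q = ln M"
    using M by (simp add: ln_div)
  then have "complexity \<alpha> ?F ?\<rho> = ln M"
    unfolding complexity_def using upper qF by (intro cSup_eq_maximum) (auto intro: rev_image_eqI)
  then show ?thesis
    by (simp add: M_def)
qed

lemma C_fin_set:
  assumes "t > 0" "sorted_wrt (<) xs"
  shows "C_fin \<alpha> t (set xs) = ln (1 + gap_sum t xs)"
  using assms complexity_set by (cases "xs = []") (auto simp: C_fin_def)

section \<open>Compact subsets of the line\<close>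

lemma tanh_real_le_self:
  fixes x :: real
  assumes "x \<ge> 0"
  shows "tanh x \<le> x"
proof -
  have "(\<lambda>x. x - tanh x) 0 \<le> (\<lambda>x. x - tanh x) x"
    by (rule DERIV_nonneg_imp_nondecreasing[OF assms])
      (auto intro!: exI derivative_eq_intros simp: power2_eq_square)
  then show ?thesis
    by simp
qed

text \<open>Concavity of \<open>tanh\<close> on the half-line with \<open>tanh 0 = 0\<close>: the
  difference of the two sides vanishes at 0 and has derivative
  \<open>c * ((tanh y)\<^sup>2 - (tanh (c * y))\<^sup>2) \<ge> 0\<close>.\<close>

lemma tanh_real_mult_ge:
  fixes x :: real
  assumes "x \<ge> 0" "0 \<le> c" "c \<le> 1"
  shows "c * tanh x \<le> tanh (c * x)"
proof -
  have "(\<lambda>x. tanh (c * x) - c * tanh x) 0 \<le> (\<lambda>x. tanh (c * x) - c * tanh x) x"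
  proof (rule DERIV_nonneg_imp_nondecreasing[OF assms(1)])
    fix y :: real assume y: "0 \<le> y" "y \<le> x"
    have "((\<lambda>x. tanh (c * x) - c * tanh x) has_real_derivative c * ((tanh y)\<^sup>2 - (tanh (c * y))\<^sup>2)) (at y)"
      by (auto intro!: derivative_eq_intros simp: algebra_simps)
    moreover have "(tanh (c * y))\<^sup>2 \<le> (tanh y)\<^sup>2"
      using y assms by (intro power_mono) (auto simp: mult_left_le_one_le)
    ultimately show "\<exists>d. ((\<lambda>x. tanh (c * x) - c * tanh x) has_real_derivative d) (at y) \<and> 0 \<le> d"
      using assms by auto
  qed
  then show ?thesis
    by simp
qed

text \<open>Since \<open>tanh\<close> lies below the identity on the half-line, the gaps telescope.
  The bound depends only on the end points, so it is uniform over the finite subsets of a bounded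
  set.\<close>

lemma gap_sum_le:
  assumes "t > 0" "sorted_wrt (<) xs" "xs \<noteq> []"
  shows "gap_sum t xs \<le> t * (last xs - hd xs) / 2"
  using assms
proof (induction t xs rule: gap_sum.induct)
  case (1 t x y xs)
  have "tanh (t * (y - x) / 2) \<le> t * (y - x) / 2"
    using "1.prems" by (intro tanh_real_le_self) auto
  with 1 show ?case
    by (auto simp: field_simps)
qed auto

lemma bdd_above_C_fin:
  fixes K :: "real set"
  assumes t: "t > 0" and K: "compact K"
  shows "bdd_above (C_fin \<alpha> t ` {F. F \<subseteq> K \<and> finite F})"
proof -
  obtain b where b: "b > 0" "\<And>x. x \<in> K \<Longrightarrow> \<bar>x\<bar> \<le> b"
    using compact_imp_bounded[OF K] by (auto simp: bounded_pos)
  have "C_fin \<alpha> t F \<le> ln (1 + t * b)" if F: "F \<subseteq> K" "finite F" for F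
  proof -
    define xs where "xs = sorted_list_of_set F"
    have xs: "sorted_wrt (<) xs" "set xs = F"
      using F by (auto simp: xs_def)
    have "gap_sum t xs \<le> t * b"
    proof (cases "xs = []")
      case True
      then show ?thesis
        using t b by simp
    next
      case False
      then have "last xs \<le> b" "- b \<le> hd xs"
        using b(2)[of "last xs"] b(2)[of "hd xs"] F xs last_in_set hd_in_set by fastforce+
      then have "t * (last xs - hd xs) \<le> t * (2 * b)"
        using t by (intro mult_left_mono) auto
      then show ?thesis
        using gap_sum_le[OF t xs(1) False] by simp
    qed
    then have "ln (1 + gap_sum t xs) \<le> ln (1 + t * b)"
      using gap_sum_nonneg[OF t xs(1)] by simp
    then show ?thesis
      using C_fin_set[OF t xs(1)] xs(2) by simp
  qed
  then show ?thesis
    by (intro bdd_aboveI2) auto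
qed

text \<open>Together with \<open>kappa_le\<close> this identifies \<open>kappa\<close> as a supremum
  of gap sums; all later arguments about \<open>kappa\<close> go through these two facts.\<close>

lemma gap_sum_le_kappa:
  assumes t: "t > 0" and K: "compact K" and xs: "sorted_wrt (<) xs" "set xs \<subseteq> K"
  shows "gap_sum t xs \<le> kappa \<alpha> t K"
proof -
  have "ln (1 + gap_sum t xs) \<le> C_compact \<alpha> t K"
    unfolding C_compact_def C_fin_set[OF t xs(1), of \<alpha>, symmetric]
    using xs by (intro cSUP_upper bdd_above_C_fin t K) auto
  then have "exp (ln (1 + gap_sum t xs)) \<le> exp (C_compact \<alpha> t K)"
    by simp
  then show ?thesis
    using gap_sum_nonneg[OF t xs(1)] by (simp add: kappa_def)
qed

lemma kappa_le:
  fixes K :: "real set"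
  assumes t: "t > 0" and le: "\<And>xs. sorted_wrt (<) xs \<Longrightarrow> set xs \<subseteq> K \<Longrightarrow> gap_sum t xs \<le> c"
  shows "kappa \<alpha> t K \<le> c"
proof -
  \<comment> \<open>The empty list has gap sum 0, so \<open>ln (1 + c)\<close> is
    meaningful.\<close>
  have c: "c \<ge> 0"
    using le[of "[]"] by simp
  have "C_compact \<alpha> t K \<le> ln (1 + c)"
    unfolding C_compact_def
  proof (rule cSUP_least)
    fix F assume "F \<in> {F. F \<subseteq> K \<and> finite F}"
    then have xs: "sorted_wrt (<) (sorted_list_of_set F)" "set (sorted_list_of_set F) = F" "F \<subseteq> K"
      by auto
    have "ln (1 + gap_sum t (sorted_list_of_set F)) \<le> ln (1 + c)"
      using le[OF xs(1)] xs gap_sum_nonneg[OF t xs(1)] by simp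
    then show "C_fin \<alpha> t F \<le> ln (1 + c)"
      using C_fin_set[OF t xs(1), of \<alpha>] xs(2) by simp
  qed auto
  then have "exp (C_compact \<alpha> t K) \<le> exp (ln (1 + c))"
    by simp
  then show ?thesis
    using c by (simp add: kappa_def)
qed

lemma kappa_nonneg:
  assumes "t > 0" "compact K"
  shows "kappa \<alpha> t (K :: real set) \<ge> 0"
  using gap_sum_le_kappa[OF assms, of "[]"] by simp

section \<open>Gap sums under concatenation, translation and dilation\<close>

lemma gap_sum_append:
  "gap_sum t (xs @ m # ys) = gap_sum t (xs @ [m]) + gap_sum t (m # ys)"
  by (induction t xs rule: gap_sum.induct) (cases ys; simp)+

lemma gap_sum_translate: "gap_sum t (map (\<lambda>x. x + c) xs) = gap_sum t xs"
  by (induction t xs rule: gap_sum.induct) auto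

lemma gap_sum_dilate:
  assumes "t > 0" "sorted_wrt (<) xs" "0 \<le> c" "c \<le> 1"
  shows "c * gap_sum t xs \<le> gap_sum t (map ((*) c) xs)"
  using assms
proof (induction t xs rule: gap_sum.induct)
  case (1 t x y xs)
  have "c * tanh (t * (y - x) / 2) \<le> tanh (c * (t * (y - x) / 2))"
    using "1.prems" by (intro tanh_real_mult_ge) auto
  with 1 show ?case
    by (auto simp: algebra_simps)
qed auto

section \<open>Superadditivity for Minkowski sums\<close>

lemma gap_sum_add_le_kappa_plus:
  fixes A B :: "real set"
  assumes t: "t > 0" and AB: "compact (A + B)"
    and xs: "sorted_wrt (<) xs" "set xs \<subseteq> A" "xs \<noteq> []"
    and ys: "sorted_wrt (<) ys" "set ys \<subseteq> B" "ys \<noteq> []"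
  shows "gap_sum t xs + gap_sum t ys \<le> kappa \<alpha> t (A + B)"
proof -
  obtain us a where us: "xs = us @ [a]"
    using xs(3) by (metis rev_exhaust)
  obtain b vs where vs: "ys = b # vs"
    using ys(3) by (metis neq_Nil_conv)
  \<comment> \<open>Here \<open>a\<close> is the last point of \<open>xs\<close> and
    \<open>b\<close> the first of \<open>ys\<close>. The translate of \<open>xs\<close> by
    \<open>b\<close> ends at \<open>a + b\<close>, where the translate of \<open>ys\<close> by
    \<open>a\<close> begins; listing this point once loses no gap.\<close>
  define zs where "zs = map (\<lambda>x. x + b) us @ (a + b) # map (\<lambda>y. y + a) vs"
  have "gap_sum t zs = gap_sum t (map (\<lambda>x. x + b) xs) + gap_sum t (map (\<lambda>y. y + a) ys)"
    unfolding zs_def by (subst gap_sum_append) (simp add: us vs add.commute)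
  then have "gap_sum t zs = gap_sum t xs + gap_sum t ys"
    by (simp only: gap_sum_translate)
  moreover have "sorted_wrt (<) zs"
    using xs(1) ys(1) unfolding zs_def us vs
    by (auto simp: sorted_wrt_append sorted_wrt_map) (metis add.commute add_strict_mono)
  moreover have "set zs \<subseteq> A + B"
    using xs(2) ys(2) unfolding zs_def us vs
    by (auto intro: set_plus_intro) (metis add.commute set_plus_intro subsetD)
  ultimately show ?thesis
    using gap_sum_le_kappa[OF t AB] by metis
qed

lemma kappa_plus_ge:
  fixes A B :: "real set"
  assumes t: "t > 0" and A: "A \<noteq> {}" "compact A" and B: "B \<noteq> {}" "compact B"
  shows "kappa \<alpha> t A + kappa \<alpha> t B \<le> kappa \<alpha> t (A + B)"
proof -
  have AB: "compact (A + B)"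
  proof -
    have "A + B = {x + y |x y. x \<in> A \<and> y \<in> B}"
      by (auto simp: set_plus_def)
    then show ?thesis
      using compact_sums[OF A(2) B(2)] by simp
  qed
  have sum_le: "gap_sum t xs + gap_sum t ys \<le> kappa \<alpha> t (A + B)"
    if xs: "sorted_wrt (<) xs" "set xs \<subseteq> A" and ys: "sorted_wrt (<) ys" "set ys \<subseteq> B" for xs ys
  proof -
    obtain a b where ab: "a \<in> A" "b \<in> B"
      using A(1) B(1) by blast
    \<comment> \<open>Gluing needs an end point on each side. An empty list is replaced by a
      singleton, which also has gap sum 0.\<close>
    define xs' where "xs' = (if xs = [] then [a] else xs)"
    define ys' where "ys' = (if ys = [] then [b] else ys)"
    have "gap_sum t xs' + gap_sum t ys' \<le> kappa \<alpha> t (A + B)"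
      using xs ys ab by (intro gap_sum_add_le_kappa_plus t AB) (auto simp: xs'_def ys'_def)
    then show ?thesis
      by (simp add: xs'_def ys'_def split: if_splits)
  qed
  \<comment> \<open>The suprema are taken one after the other: first over \<open>xs\<close> with
    \<open>ys\<close> fixed, then over \<open>ys\<close>.\<close>
  have "kappa \<alpha> t A \<le> kappa \<alpha> t (A + B) - gap_sum t ys"
    if "sorted_wrt (<) ys" "set ys \<subseteq> B" for ys
    using sum_le[OF _ _ that] by (intro kappa_le t) (simp add: le_diff_eq)
  then have "kappa \<alpha> t B \<le> kappa \<alpha> t (A + B) - kappa \<alpha> t A"
    by (intro kappa_le t) (simp add: le_diff_eq add.commute)
  then show ?thesis
    by simp
qed

section \<open>Dilates and convex combinations\<close>

lemma elt_set_times_eq_image: "c *o A = (*) c ` A"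
  by (auto simp: elt_set_times_def)

lemma compact_elt_set_times:
  fixes K :: "real set"
  assumes "compact K"
  shows "compact (c *o K)"
  unfolding elt_set_times_eq_image by (intro compact_continuous_image continuous_intros assms)

lemma kappa_dilate_ge:
  fixes K :: "real set"
  assumes t: "t > 0" and K: "compact K" and c: "0 \<le> c" "c \<le> 1"
  shows "c * kappa \<alpha> t K \<le> kappa \<alpha> t (c *o K)"
proof (cases "c = 0")
  case True
  then show ?thesis
    using kappa_nonneg[OF t compact_elt_set_times[OF K]] by simp
next
  case False
  \<comment> \<open>For \<open>c > 0\<close>, dilation keeps a list strictly increasing, so the
    bound on gap sums passes to the supremum.\<close>
  have "kappa \<alpha> t K \<le> kappa \<alpha> t (c *o K) / c"
  proof (rule kappa_le[OF t])
    fix xs assume xs: "sorted_wrt (<) xs" "set xs \<subseteq> K"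
    have "c * gap_sum t xs \<le> gap_sum t (map ((*) c) xs)"
      using t xs c by (intro gap_sum_dilate) auto
    also have "\<dots> \<le> kappa \<alpha> t (c *o K)"
      using xs c False
      by (intro gap_sum_le_kappa t compact_elt_set_times K) (auto simp: sorted_wrt_map elt_set_times_eq_image)
    finally show "gap_sum t xs \<le> kappa \<alpha> t (c *o K) / c"
      using c False by (simp add: field_simps)
  qed
  then show ?thesis
    using c False by (simp add: field_simps)
qed

theorem theorem1p10:
  fixes A B :: "real set" and \<alpha> :: ennreal
  assumes "A \<noteq> {}" "compact A" and "B \<noteq> {}" "compact B"
  shows "(\<forall>t>0. kappa \<alpha> t (A + B) \<ge> kappa \<alpha> t A + kappa \<alpha> t B) \<and>
    (\<forall>l\<in>{0..1}. \<forall>t>0. kappa \<alpha> t ((1 - l) *o A + l *o B)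
        \<ge> (1 - l) * kappa \<alpha> t A + l * kappa \<alpha> t B)"
proof (intro conjI ballI allI impI)
  fix t :: real assume "t > 0"
  then show "kappa \<alpha> t (A + B) \<ge> kappa \<alpha> t A + kappa \<alpha> t B"
    using kappa_plus_ge assms by blast
next
  fix l t :: real assume l: "l \<in> {0..1}" and t: "t > 0"
  have "kappa \<alpha> t ((1 - l) *o A) + kappa \<alpha> t (l *o B) \<le> kappa \<alpha> t ((1 - l) *o A + l *o B)"
    using assms by (intro kappa_plus_ge compact_elt_set_times t) (auto simp: elt_set_times_eq_image)
  then show "kappa \<alpha> t ((1 - l) *o A + l *o B) \<ge> (1 - l) * kappa \<alpha> t A + l * kappa \<alpha> t B"
    using kappa_dilate_ge[OF t assms(2), of "1 - l" \<alpha>] kappa_dilate_ge[OF t assms(4), of l \<alpha>] l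
    by simp
qed

end
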